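(* Let $R$ be a commutative ring. Let $n$ be a positive integer and $p\in\mathbb{Z}$. Let $h_{k,\,i}$ be an element of $R$ for all $k\in\mathbb{Z}$ and $i\in[n]$. Assume that $$h_{k,\,n}=0\quad\text{for all }k<0.$$ For any $m\in\{0,1,\ldots,n\}$ and any $\lambda\in\mathbb{Z}^m$, define $$s_\lambda:=\det\left(\left(h_{\lambda_i+j-i,\,i}\right)_{i,j\in[m]}\right)\in R.$$ Fix an $n$-tuple $\mu\in\mathbb{Z}^n$ with $\mu_n=0$. Let $\overline{\mu}=(\mu_1,\mu_2,\ldots,\mu_{n-1})$. Then $$h_{p,\,n}\cdot s_{\overline{\mu}}=\sum_{\substack{\beta\in\mathbb{N}^n;\\ |\beta|=p}}s_{\mu+\beta}.$$
   Context: $\mathbb{N}=\{0,1,2,\ldots\}$ and $[m]=\{1,2,\ldots,m\}$. For a tuple $\alpha$, $\alpha_i$ denotes its $i$-th entry, and for $\alpha\in\mathbb{Z}^n$ we set $|\alpha|:=\alpha_1+\cdots+\alpha_n$. Addition of tuples is entrywise. $(a_{i,j})_{i,j\in[m]}$ denotes the $m\times m$-matrix with $(i,j)$-th entry $a_{i,j}$. *)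

theory Defs
  imports Jordan_Normal_Form.Determinant
begin

(* Tuples are lists, so the size of the matrix is the length of lam.  Tuple and matrix
   indices start at 0 here: with i, j counted from 1, the entry is h (lam_i + j - i) i.
   The second argument of h is always counted from 1. *)
definition s_det :: "(int \<Rightarrow> nat \<Rightarrow> 'a :: comm_ring_1) \<Rightarrow> int list \<Rightarrow> 'a" where
  "s_det h lam =
     det (mat (length lam) (length lam)
       (\<lambda>(i, j). h (lam ! i + int (Suc j) - int (Suc i)) (Suc i)))"

definition weak_compositions :: "nat \<Rightarrow> int \<Rightarrow> nat list set" where
  "weak_compositions n p = {\<beta>. length \<beta> = n \<and> int (sum_list \<beta>) = p}"

definition tuple_add :: "int list \<Rightarrow> nat list \<Rightarrow> int list" where
  "tuple_add \<mu> \<beta> = map2 (\<lambda>a b. a + int b) \<mu> \<beta>"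

(* guards against the convention that a sum over an infinite set is 0 *)
lemma finite_weak_compositions: "finite (weak_compositions n p)"
proof (rule finite_subset)
  show "weak_compositions n p \<subseteq> {xs. set xs \<subseteq> {..nat p} \<and> length xs = n}"
    using member_le_sum_list by (fastforce simp: weak_compositions_def)
  show "finite {xs. set xs \<subseteq> {..nat p} \<and> length xs = n}"
    by (rule finite_lists_length_eq) simp
qed

end

theory Submission
  imports Defs "HOL-Computational_Algebra.Formal_Power_Series"
begin

text \<open>
  Since \<open>\<beta>\<^sub>i\<close> only shifts row \<open>i\<close>, multilinearity in the rows identifies the sum with the coefficient
  of \<open>t\<^sup>p\<close> in \<open>det F\<close>, where \<open>F\<^sub>i\<^sub>j = \<Sum>\<^sub>b a\<^sub>i (j + b) t\<^sup>b\<close> and \<open>a\<^sub>i (j)\<close> is the unshifted entry.  As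
  \<open>F\<^sub>i\<^sub>j - t F\<^sub>i\<^sub>,\<^sub>j\<^sub>+\<^sub>1 = a\<^sub>i (j)\<close>, column operations make all columns but the last one constant.
  Because \<open>\<mu>\<^sub>n = 0\<close>, the last row then vanishes off the diagonal, and expanding along it gives the product.
\<close>

lemma fps_nth_prod_atLeast0LessThan:
  fixes f :: "nat \<Rightarrow> 'a :: comm_ring_1 fps"
  assumes "n > 0"
  shows "fps_nth (\<Prod>i = 0..<n. f i) k = (\<Sum>v\<in>natpermute k n. \<Prod>i = 0..<n. fps_nth (f i) (v ! i))"
proof -
  obtain m where "n = Suc m"
    using assms gr0_implies_Suc by blast
  then show ?thesis
    using fps_prod_nth[of f m k] by (simp add: atLeastLessThanSuc_atLeastAtMost)
qed

text \<open>Each Leibniz term takes one entry from every row, so the exponents in its Cauchy product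
  are indexed by rows. The same \<beta> thus serves all permutations, and the two sums can be
  swapped.\<close>

lemma det_fps_nth:
  fixes a :: "nat \<Rightarrow> nat \<Rightarrow> nat \<Rightarrow> 'a :: comm_ring_1"
  assumes "n > 0"
  shows "fps_nth (det (mat n n (\<lambda>(i, j). Abs_fps (a i j)))) k =
    (\<Sum>\<beta>\<in>natpermute k n. det (mat n n (\<lambda>(i, j). a i j (\<beta> ! i))))"
proof -
  let ?P = "{\<pi>. \<pi> permutes {0..<n}}"
  have lt: "\<pi> i < n" if "\<pi> permutes {0..<n}" "i < n" for \<pi> i
    using permutes_in_image[OF that(1), of i] that(2) by simp
  have "fps_nth (det (mat n n (\<lambda>(i, j). Abs_fps (a i j)))) k =
    (\<Sum>\<pi>\<in>?P. fps_nth (signof \<pi> * (\<Prod>i = 0..<n. Abs_fps (a i (\<pi> i)))) k)"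
    by (simp add: det_def fps_sum_nth lt)
  also have "\<dots> = (\<Sum>\<pi>\<in>?P. signof \<pi> * (\<Sum>\<beta>\<in>natpermute k n. \<Prod>i = 0..<n. a i (\<pi> i) (\<beta> ! i)))"
    by (intro sum.cong refl)
      (simp add: sign_def fps_nth_prod_atLeast0LessThan[OF assms])
  also have "\<dots> = (\<Sum>\<beta>\<in>natpermute k n. \<Sum>\<pi>\<in>?P. signof \<pi> * (\<Prod>i = 0..<n. a i (\<pi> i) (\<beta> ! i)))"
    by (simp add: sum_distrib_left) (rule sum.swap)
  also have "\<dots> = (\<Sum>\<beta>\<in>natpermute k n. det (mat n n (\<lambda>(i, j). a i j (\<beta> ! i))))"
    by (simp add: det_def lt)
  finally show ?thesis .
qed

lemma det_subtract_next_columns: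
  fixes F :: "nat \<Rightarrow> nat \<Rightarrow> 'a :: comm_ring_1"
  shows "det (mat n n (\<lambda>(i, j). if Suc j < n then F i j - t * F i (Suc j) else F i j)) =
    det (mat n n (\<lambda>(i, j). F i j))"
proof -
  \<comment> \<open>Right multiplication by this unit lower bidiagonal matrix performs all column
    operations at once, each with the original next column.\<close>
  define U where "U = mat n n (\<lambda>(i, j). if i = j then 1 else if i = Suc j then - t else 0)"
  have U: "U \<in> carrier_mat n n"
    by (simp add: U_def)
  have "diag_mat U = replicate n 1"
    by (rule nth_equalityI) (simp_all add: U_def diag_mat_def)
  then have "det U = 1"
    using det_lower_triangular[OF _ U] by (simp add: U_def)
  moreover have "mat n n (\<lambda>(i, j). F i j) * U =
      mat n n (\<lambda>(i, j). if Suc j < n then F i j - t * F i (Suc j) else F i j)" (is "?A * U = ?B")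
  proof (rule eq_matI)
    fix i j assume "i < dim_row ?B" "j < dim_col ?B"
    then have ij: "i < n" "j < n" by simp_all
    have "(?A * U) $$ (i, j) =
        (\<Sum>k = 0..<n. F i k * (if k = j then 1 else if k = Suc j then - t else 0))"
      using ij by (simp add: U_def scalar_prod_def)
    also have "\<dots> = (\<Sum>k = 0..<n. (if k = j then F i j else 0)
        + (if k = Suc j then - t * F i (Suc j) else 0))"
      by (intro sum.cong) (auto simp: mult.commute)
    \<comment> \<open>For \<open>Suc j = n\<close> the second indicator never fires, so the last
      column stays unchanged.\<close>
    also have "\<dots> = ?B $$ (i, j)"
      using ij by (simp add: sum.distrib)
    finally show "(?A * U) $$ (i, j) = ?B $$ (i, j)" .
  qed (simp_all add: U_def)
  ultimately show ?thesis
    using det_mult[of ?A n U] U by simp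
qed

lemma det_last_row_zero:
  fixes M :: "'a :: comm_ring_1 mat"
  assumes M: "M \<in> carrier_mat (Suc m) (Suc m)"
    and zero: "\<And>j. j < m \<Longrightarrow> M $$ (m, j) = 0"
  shows "det M = M $$ (m, m) * det (mat m m (($$) M))"
proof -
  have "det M = (\<Sum>j<Suc m. M $$ (m, j) * cofactor M m j)"
    by (rule laplace_expansion_row[OF M]) simp
  also have "\<dots> = M $$ (m, m) * cofactor M m m"
    by (simp add: zero)
  also have "mat_delete M m m = mat m m (($$) M)"
    using M by (auto simp: mat_delete_def)
  \<comment> \<open>The corner sign is \<open>(-1) ^ (m + m)\<close>; writing \<open>m + m\<close>
    as \<open>2 * m\<close> shows that it is 1.\<close>
  then have "cofactor M m m = det (mat m m (($$) M))"
    by (simp add: cofactor_def flip: mult_2)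
  finally show ?thesis .
qed

lemma det_fps_const: "det (map_mat fps_const A) = fps_const (det (A :: 'a :: comm_ring_1 mat))"
proof -
  interpret comm_ring_hom "fps_const :: 'a \<Rightarrow> 'a fps"
    by unfold_locales simp_all
  show ?thesis
    by (simp add: hom_det)
qed

lemma weak_compositions_of_nat: "weak_compositions n (int k) = natpermute k n"
  by (auto simp: weak_compositions_def natpermute_def)

lemma weak_compositions_neg: "p < 0 \<Longrightarrow> weak_compositions n p = {}"
  by (auto simp: weak_compositions_def)

theorem corollary3p6:
  fixes h :: "int \<Rightarrow> nat \<Rightarrow> 'a :: comm_ring_1"
    and n :: nat and p :: int and \<mu> :: "int list"
  assumes "n \<ge> 1"
    and "\<And>k. k < 0 \<Longrightarrow> h k n = 0"
    and "length \<mu> = n"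
    and "\<mu> ! (n - 1) = 0"
  shows "h p n * s_det h (butlast \<mu>) =
    (\<Sum>\<beta>\<in>weak_compositions n p. s_det h (tuple_add \<mu> \<beta>))"
proof (cases "p < 0")
  case True
  then show ?thesis
    by (simp add: assms(2) weak_compositions_neg)
next
  case False
  then obtain k where k: "p = int k"
    using nonneg_int_cases[of p] by auto
  obtain m where m: "n = Suc m"
    using assms(1) by (cases n) auto
  define a where "a i j = h (\<mu> ! i + int j - int i) (Suc i)" for i j :: nat
  define F where "F i j = Abs_fps (\<lambda>b. a i (j + b))" for i j
  define G where "G = mat n n (\<lambda>(i, j). if Suc j < n then F i j - fps_X * F i (Suc j) else F i j)"
  \<comment> \<open>Coefficient \<open>b + 1\<close> of \<open>F i j\<close> is coefficient
    \<open>b\<close> of \<open>F i (Suc j)\<close>, so only the constant term survives.\<close>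
  have F_shift: "F i j - fps_X * F i (Suc j) = fps_const (a i j)" for i j
    by (rule fps_ext) (auto simp: F_def)
  \<comment> \<open>As \<mu> ends in 0, the entry is the constant with value
    \<open>h (int j - int m) n\<close>, whose first argument is negative.\<close>
  have last_row: "G $$ (m, j) = 0" if "j < m" for j
    using that assms(2,4) m by (simp add: G_def F_shift a_def)
  \<comment> \<open>Dropping the last column leaves only constant ones; dropping the last row
    removes the last entry of \<mu>.\<close>
  have "mat m m (($$) G) = map_mat fps_const (mat m m (\<lambda>(i, j). a i j))"
    by (auto simp: G_def F_shift m)
  moreover have "mat m m (\<lambda>(i, j). a i j) = mat (length (butlast \<mu>)) (length (butlast \<mu>))
      (\<lambda>(i, j). h (butlast \<mu> ! i + int (Suc j) - int (Suc i)) (Suc i))"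
    using assms(3) m by (intro eq_matI) (auto simp: a_def nth_butlast algebra_simps)
  ultimately have minor: "det (mat m m (($$) G)) = fps_const (s_det h (butlast \<mu>))"
    by (simp only: det_fps_const s_det_def)
  \<comment> \<open>Row \<open>i\<close> sees its entry of \<mu> and the column index only through
    their sum, so the shift moves into the column index.\<close>
  have "s_det h (tuple_add \<mu> \<beta>) = det (mat n n (\<lambda>(i, j). a i (j + \<beta> ! i)))"
    if "\<beta> \<in> natpermute k n" for \<beta>
  proof -
    have len: "length \<beta> = n"
      using that by (simp add: natpermute_def)
    show ?thesis
      unfolding s_det_def using len assms(3)
      by (intro arg_cong[of _ _ det] eq_matI) (auto simp: a_def tuple_add_def algebra_simps)
  qed
  then have "(\<Sum>\<beta>\<in>weak_compositions n p. s_det h (tuple_add \<mu> \<beta>)) =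
      (\<Sum>\<beta>\<in>natpermute k n. det (mat n n (\<lambda>(i, j). a i (j + \<beta> ! i))))"
    by (simp add: k weak_compositions_of_nat)
  also have "\<dots> = fps_nth (det (mat n n (\<lambda>(i, j). F i j))) k"
    using det_fps_nth[of n "\<lambda>i j b. a i (j + b)" k] m by (simp add: F_def)
  also have "det (mat n n (\<lambda>(i, j). F i j)) = det G"
    by (simp only: G_def det_subtract_next_columns)
  also have "det G = F m m * fps_const (s_det h (butlast \<mu>))"
    using det_last_row_zero[of G m] last_row minor by (simp add: G_def m)
  \<comment> \<open>The coefficient of \<open>F m m\<close> is \<open>a m (m + k)\<close>, which is
    \<open>h p n\<close> because \<mu> ends in 0.\<close>
  also have "fps_nth (F m m * fps_const (s_det h (butlast \<mu>))) k = h p n * s_det h (butlast \<mu>)"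
    using assms(4) by (simp add: F_def a_def m k)
  finally show ?thesis ..
qed

end
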